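(* Let $S=\sum_{n=0}^{\infty}a_n$ with $a_n\in\mathbb{R}$ be a conditionally divergent series, and let \[ Z_R=\Big\{r\in\mathbb{R} : r=\sum_{n=0}^{\infty}a_{\sigma(n)} \text{ for some type R } \lambda\text{-permutation } \sigma \text{ of } S\Big\}. \] If $S$ cannot be rearranged to converge to any value by any type R $\lambda$-permutation, then $Z_R=\emptyset$. Otherwise (i.e. $|Z_R|\ge 1$): (1) if $S$ satisfies both $ST_P$ and $ST_N$, then $Z_R=\mathbb{R}$; (2) if $S$ violates $ST_P$ or violates $ST_N$, then $Z_R$ is a singleton, i.e. $|Z_R|=1$.
   Context: A series $\sum a_n$ of reals is conditionally divergent if it diverges but some permutation $\sigma$ of the index set makes $\sum a_{\sigma(n)}$ converge; such a $\sigma$ is said to fix the series. Block number: for a permutation $\sigma$ of the index set and each $n$, the set $\{\sigma(0),\dots,\sigma(n)\}$ is a disjoint union of maximal sets of consecutive integers ("blocks"); let $b_n$ be the number of these blocks. $\sigma$ has bounded block number if $\sup_n b_n<\infty$ (any upper bound is called a bounded block number of $\sigma$). Let $P=\{n: a_n>0\}$ (positive indices) and $N=\{n : a_n\le 0\}$ (negative indices). A permutation $\sigma$ is type R for $S$ if it preserves the relative order of same-sign terms: whenever $\sigma(i)<\sigma(j)$ and $\sigma(i),\sigma(j)$ are both in $P$ or both in $N$, then $i<j$. A type R $\lambda$-permutation of $S$ is a permutation $\sigma$ that is type R, has bounded block number, and fixes $S$ (i.e. $\sum_n a_{\sigma(n)}$ converges). Write $P$ as the union of its maximal intervals of consecutive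 integers listed in increasing order, $P=P_1\cup P_2\cup\cdots$ (the positive blocks), and similarly $N=N_1\cup N_2\cup\cdots$ (the negative blocks). For $i\le j$ let $S_{[P_i,P_j]}=\sum_{n\in P_i\cup\cdots\cup P_j}a_n$ and $S_{[N_i,N_j]}=\sum_{n\in N_i\cup\cdots\cup N_j}a_n$. Substantial property: $S$ satisfies $ST_P$ if there exist $k\in\mathbb{N}$, $\epsilon>0$ and $i_0\in\mathbb{N}$ such that $S_{[P_i,P_{i+k}]}\ge\epsilon$ for all $i>i_0$. $S$ satisfies $ST_N$ if there exist $k\in\mathbb{N}$, $\epsilon>0$ and $i_0\in\mathbb{N}$ such that $S_{[N_i,N_{i+k}]}\le-\epsilon$ for all $i>i_0$. *)

theory Defs
  imports Complex_Main
begin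

definition conditionally_divergent :: "(nat \<Rightarrow> real) \<Rightarrow> bool" where
  "conditionally_divergent a \<longleftrightarrow>
     \<not> summable a \<and> (\<exists>\<sigma>. bij \<sigma> \<and> summable (\<lambda>n. a (\<sigma> n)))"

definition consecutive :: "nat set \<Rightarrow> bool" where
  "consecutive B \<longleftrightarrow> B \<noteq> {} \<and> (\<forall>x\<in>B. \<forall>z\<in>B. \<forall>y. x \<le> y \<and> y \<le> z \<longrightarrow> y \<in> B)"

definition blocks :: "nat set \<Rightarrow> nat set set" where
  "blocks A = {B. B \<subseteq> A \<and> consecutive B \<and>
                  (\<forall>C. C \<subseteq> A \<and> consecutive C \<and> B \<subseteq> C \<longrightarrow> C = B)}"

definition block_number :: "(nat \<Rightarrow> nat) \<Rightarrow> nat \<Rightarrow> nat" where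
  "block_number \<sigma> n = card (blocks (\<sigma> ` {0..n}))"

definition bounded_block_number :: "(nat \<Rightarrow> nat) \<Rightarrow> bool" where
  "bounded_block_number \<sigma> \<longleftrightarrow> (\<exists>M. \<forall>n. block_number \<sigma> n \<le> M)"

definition pos_indices :: "(nat \<Rightarrow> real) \<Rightarrow> nat set" where
  "pos_indices a = {n. a n > 0}"

definition neg_indices :: "(nat \<Rightarrow> real) \<Rightarrow> nat set" where
  "neg_indices a = {n. a n \<le> 0}"

definition type_R :: "(nat \<Rightarrow> real) \<Rightarrow> (nat \<Rightarrow> nat) \<Rightarrow> bool" where
  "type_R a \<sigma> \<longleftrightarrow>
     (\<forall>i j. \<sigma> i < \<sigma> j \<and>
        (\<sigma> i \<in> pos_indices a \<and> \<sigma> j \<in> pos_indices a \<or>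
         \<sigma> i \<in> neg_indices a \<and> \<sigma> j \<in> neg_indices a) \<longrightarrow> i < j)"

definition type_R_lambda_perm :: "(nat \<Rightarrow> real) \<Rightarrow> (nat \<Rightarrow> nat) \<Rightarrow> bool" where
  "type_R_lambda_perm a \<sigma> \<longleftrightarrow>
     bij \<sigma> \<and> type_R a \<sigma> \<and> bounded_block_number \<sigma> \<and> summable (\<lambda>n. a (\<sigma> n))"

text \<open>
  The \<open>i\<close>-th block of \<open>A\<close> in increasing order, counted from \<open>1\<close>: the block such that exactly
  \<open>i\<close> blocks start no later than it does. It is meaningful only for \<open>i \<ge> 1\<close> and if \<open>A\<close> has at
  least \<open>i\<close> blocks. For a conditionally divergent series the positive and the negative indices
  both form infinite sets, so each has infinitely many blocks, all of them finite.
\<close>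

definition nth_block :: "nat set \<Rightarrow> nat \<Rightarrow> nat set" where
  "nth_block A i = (THE B. B \<in> blocks A \<and> card {C \<in> blocks A. Inf C \<le> Inf B} = i)"

definition block_sum :: "(nat \<Rightarrow> real) \<Rightarrow> nat set \<Rightarrow> nat \<Rightarrow> nat \<Rightarrow> real" where
  "block_sum a A i j = (\<Sum>n \<in> (\<Union>m\<in>{i..j}. nth_block A m). a n)"

definition ST_P :: "(nat \<Rightarrow> real) \<Rightarrow> bool" where
  "ST_P a \<longleftrightarrow>
     (\<exists>k::nat. \<exists>\<epsilon>>0. \<exists>i0::nat. \<forall>i>i0. block_sum a (pos_indices a) i (i + k) \<ge> \<epsilon>)"

definition ST_N :: "(nat \<Rightarrow> real) \<Rightarrow> bool" where
  "ST_N a \<longleftrightarrow>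
     (\<exists>k::nat. \<exists>\<epsilon>>0. \<exists>i0::nat. \<forall>i>i0. block_sum a (neg_indices a) i (i + k) \<le> - \<epsilon>)"

definition Z_R :: "(nat \<Rightarrow> real) \<Rightarrow> real set" where
  "Z_R a = {r. \<exists>\<sigma>. type_R_lambda_perm a \<sigma> \<and> (\<lambda>n. a (\<sigma> n)) sums r}"

end

theory Submission
  imports Defs "HOL-Library.Infinite_Set"
begin

text \<open>
  After finitely many steps a type R rearrangement has used the positive indices below some \<open>x\<close> and
  the negative indices below some \<open>y\<close>, and its block number is, up to an additive constant, the
  number of sign blocks between \<open>x\<close> and \<open>y\<close>. Hence two such rearrangements with bounded block
  number, stopped just before the same negative index, have used up almost the same number of
  positive blocks. If \<open>ST_P\<close> fails, this can be done inside long stretches of negligible positive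
  blocks, so the two sums agree; if \<open>ST_N\<close> fails, exchange the signs. If \<open>ST_P\<close> holds, Riemann's greedy
  rearrangement towards any target stays within a bounded number of blocks of the given one, because
  a bounded difference of partial sums is a bounded number of substantial blocks.
\<close>

subsection \<open>Blocks of a set of natural numbers\<close>

definition block_starts :: "nat set \<Rightarrow> nat set" where
  "block_starts A = {n\<in>A. \<forall>m. n = Suc m \<longrightarrow> m \<notin> A}"

text \<open>For \<open>n\<close> in \<open>A\<close> this is the number of the block containing
  \<open>n\<close>, counted from 1; for \<open>n\<close> outside \<open>A\<close> it is the number
  of the last block before \<open>n\<close>, or 0. It replaces sets of blocks by a monotone function
  of the position.\<close>

definition block_rank :: "nat set \<Rightarrow> nat \<Rightarrow> nat" where
  "block_rank A n = card {s\<in>block_starts A. s \<le> n}"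

definition block_of :: "nat set \<Rightarrow> nat \<Rightarrow> nat set" where
  "block_of A n = {m\<in>A. block_rank A m = block_rank A n}"

lemma block_rank_mono: "m \<le> n \<Longrightarrow> block_rank A m \<le> block_rank A n"
  unfolding block_rank_def by (rule card_mono) auto

lemma block_rank_split:
  assumes "m \<le> n"
  shows "block_rank A n = block_rank A m + card {s\<in>block_starts A. m < s \<and> s \<le> n}"
proof -
  have "{s\<in>block_starts A. s \<le> n} =
      {s\<in>block_starts A. s \<le> m} \<union> {s\<in>block_starts A. m < s \<and> s \<le> n}"
    using assms by auto
  then show ?thesis
    unfolding block_rank_def by (simp add: card_Un_disjoint disjoint_iff)
qed

lemma block_rank_0: "block_rank A 0 = (if 0 \<in> A then 1 else 0)"
proof -
  have "{s\<in>block_starts A. s \<le> 0} = (if 0 \<in> A then {0} else {})"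
    by (auto simp: block_starts_def)
  then show ?thesis
    by (simp add: block_rank_def)
qed

lemma block_rank_Suc:
  "block_rank A (Suc n) = block_rank A n + (if Suc n \<in> A \<and> n \<notin> A then 1 else 0)"
proof -
  have "{s\<in>block_starts A. n < s \<and> s \<le> Suc n} = (if Suc n \<in> A \<and> n \<notin> A then {Suc n} else {})"
    by (auto simp: block_starts_def le_Suc_eq)
  then show ?thesis
    using block_rank_split[of n "Suc n" A] by simp
qed

lemma block_rank_le_Suc: "block_rank A n \<le> Suc n"
  by (induction n) (auto simp: block_rank_0 block_rank_Suc)

text \<open>Blocks of \<open>A\<close> and of \<open>- A\<close> alternate, so neither count gets
  ahead by more than one.\<close>

lemma block_rank_Compl:
  "block_rank A n \<le> block_rank (- A) n + 1" "block_rank (- A) n \<le> block_rank A n + 1"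
proof -
  \<comment> \<open>Exact invariant: the side containing 0 leads by one while \<open>n\<close> is on
    that side and is level otherwise.\<close>
  have "if 0 \<in> A then block_rank A n = block_rank (- A) n + (if n \<in> A then 1 else 0)
      else block_rank (- A) n = block_rank A n + (if n \<in> A then 0 else 1)"
    by (induction n) (auto simp: block_rank_0 block_rank_Suc split: if_splits)
  then show "block_rank A n \<le> block_rank (- A) n + 1" "block_rank (- A) n \<le> block_rank A n + 1"
    by (auto split: if_splits)
qed

lemma block_start_between:
  assumes "l \<notin> A" "n \<in> A" "l < n"
  shows "\<exists>s\<in>block_starts A. l < s \<and> s \<le> n"
proof -
  define s where "s = (LEAST t. l < t \<and> t \<in> A)"
  have s: "l < s" "s \<in> A"
    using LeastI[of "\<lambda>t. l < t \<and> t \<in> A" n] assms by (auto simp: s_def)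
  have min: "s \<le> t" if "l < t" "t \<in> A" for t
    unfolding s_def using that by (intro Least_le) auto
  have "s \<in> block_starts A"
  proof -
    have "m \<notin> A" if "s = Suc m" for m
      using s(1) min[of m] assms(1) that by (cases "l = m") auto
    then show ?thesis
      using s(2) by (auto simp: block_starts_def)
  qed
  then show ?thesis
    using s min assms by blast
qed

text \<open>The rank increases only at block starts, and a gap between \<open>m\<close> and
  \<open>n\<close> would force a new start after it.\<close>

lemma block_rank_eq_iff:
  assumes "m \<le> n" "n \<in> A" "m \<in> A"
  shows "block_rank A m = block_rank A n \<longleftrightarrow> {m..n} \<subseteq> A"
proof -
  have "block_rank A m = block_rank A n \<longleftrightarrow> {s\<in>block_starts A. m < s \<and> s \<le> n} = {}"
    using block_rank_split[OF assms(1), of A] by (auto simp: card_eq_0_iff)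
  also have "\<dots> \<longleftrightarrow> {m..n} \<subseteq> A"
  proof
    assume E: "{s\<in>block_starts A. m < s \<and> s \<le> n} = {}"
    show "{m..n} \<subseteq> A"
    proof (rule ccontr)
      assume "\<not> {m..n} \<subseteq> A"
      then obtain l where l: "m \<le> l" "l \<le> n" "l \<notin> A"
        unfolding subset_eq by auto
      then have "l < n"
        using assms(2) by (metis le_neq_implies_less)
      from block_start_between[OF l(3) assms(2) this] show False
        using E l by auto
    qed
  next
    assume sub: "{m..n} \<subseteq> A"
    have "s \<notin> block_starts A" if "m < s" "s \<le> n" for s
      using that sub by (cases s) (auto simp: block_starts_def)
    then show "{s\<in>block_starts A. m < s \<and> s \<le> n} = {}"
      by auto
  qed
  finally show ?thesis .
qed

section \<open>Blocks as classes of equal rank\<close>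

lemma mem_block_of: "n \<in> A \<Longrightarrow> n \<in> block_of A n"
  by (simp add: block_of_def)

lemma consecutive_block_of:
  assumes "n \<in> A"
  shows "consecutive (block_of A n)"
  unfolding consecutive_def
proof (intro conjI ballI allI impI)
  show "block_of A n \<noteq> {}"
    using assms mem_block_of by blast
next
  fix x y z
  assume xz: "x \<in> block_of A n" "z \<in> block_of A n" and "x \<le> y \<and> y \<le> z"
  then have y: "x \<le> y" "y \<le> z" by auto
  have "{x..z} \<subseteq> A"
    using block_rank_eq_iff[of x z A] xz y by (auto simp: block_of_def)
  then have "{x..y} \<subseteq> A" "y \<in> A"
    using y by auto
  then show "y \<in> block_of A n"
    using block_rank_eq_iff[of x y A] xz y by (auto simp: block_of_def)
qed

text \<open>Gives the maximality demanded by \<open>blocks\<close>: the rank is constant along a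
  consecutive subset of \<open>A\<close>.\<close>

lemma consecutive_subset_block_of:
  assumes "C \<subseteq> A" "consecutive C" "x \<in> C"
  shows "C \<subseteq> block_of A x"
proof
  fix y assume y: "y \<in> C"
  have *: "block_rank A u = block_rank A v" if "u \<le> v" "u \<in> C" "v \<in> C" for u v
  proof -
    have "{u..v} \<subseteq> A"
    proof
      fix w assume "w \<in> {u..v}"
      then have "w \<in> C"
        using assms(2) that unfolding consecutive_def by (meson atLeastAtMost_iff)
      then show "w \<in> A"
        using assms(1) by blast
    qed
    then show ?thesis
      using block_rank_eq_iff[of u v A] that assms(1) by blast
  qed
  show "y \<in> block_of A x"
    using *[OF _ assms(3) y] *[OF _ y assms(3)] y assms(1) nat_le_linear[of x y]
    unfolding block_of_def by (metis (mono_tags, lifting) mem_Collect_eq subsetD)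
qed

lemma block_of_eqI: "m \<in> block_of A n \<Longrightarrow> block_of A m = block_of A n"
  by (auto simp: block_of_def)

lemma blocks_eq_image: "blocks A = block_of A ` A"
proof (intro equalityI subsetI)
  fix B assume B: "B \<in> blocks A"
  then obtain x where x: "x \<in> B"
    by (auto simp: blocks_def consecutive_def)
  have "block_of A x = B"
  proof -
    have "x \<in> A" "B \<subseteq> block_of A x"
      using B x consecutive_subset_block_of[of B A x] by (auto simp: blocks_def)
    moreover have "block_of A x \<subseteq> A"
      by (auto simp: block_of_def)
    ultimately show ?thesis
      using B consecutive_block_of[of x A] by (auto simp: blocks_def)
  qed
  then show "B \<in> block_of A ` A"
    using B x by (auto simp: blocks_def)
next
  fix B assume "B \<in> block_of A ` A"
  then obtain n where n: "n \<in> A" "B = block_of A n"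
    by auto
  show "B \<in> blocks A"
    unfolding blocks_def
  proof (intro CollectI conjI allI impI)
    show "B \<subseteq> A" "consecutive B"
      using n consecutive_block_of by (auto simp: block_of_def)
  next
    fix C assume C: "C \<subseteq> A \<and> consecutive C \<and> B \<subseteq> C"
    then have "n \<in> C"
      using n mem_block_of by blast
    then show "C = B"
      using C consecutive_subset_block_of[of C A n] n by auto
  qed
qed

lemma block_start_exists:
  assumes "n \<in> A"
  shows "\<exists>s\<in>block_starts A. block_of A s = block_of A n"
proof -
  define s where "s = (LEAST t. t \<in> block_of A n)"
  have s: "s \<in> block_of A n"
    unfolding s_def using LeastI[of "\<lambda>t. t \<in> block_of A n"] mem_block_of[OF assms] by blast
  have min: "s \<le> t" if "t \<in> block_of A n" for t
    unfolding s_def using that by (rule Least_le)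
  have "m \<notin> A" if "s = Suc m" for m
  proof
    assume m: "m \<in> A"
    have "{m..s} \<subseteq> A"
      using m s that by (auto simp: block_of_def atLeastAtMostSuc_conv)
    then have "m \<in> block_of A n"
      using block_rank_eq_iff[of m s A] s m that by (auto simp: block_of_def)
    then show False
      using min[of m] that by simp
  qed
  then have "s \<in> block_starts A"
    using s by (auto simp: block_starts_def block_of_def)
  then show ?thesis
    using block_of_eqI[OF s] by blast
qed

lemma Inf_block_of:
  assumes "s \<in> block_starts A"
  shows "Inf (block_of A s) = s"
proof (rule cInf_eq_minimum)
  show "s \<in> block_of A s"
    using assms by (auto simp: block_starts_def block_of_def)
next
  fix m assume m: "m \<in> block_of A s"
  show "s \<le> m"
  proof (rule ccontr)
    assume "\<not> s \<le> m"
    then have "{m..s} \<subseteq> A" "m < s"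
      using block_rank_eq_iff[of m s A] m assms by (auto simp: block_of_def block_starts_def)
    then show False
      using assms by (cases s) (auto simp: block_starts_def subset_eq)
  qed
qed

lemma blocks_eq_starts: "blocks A = block_of A ` block_starts A"
proof -
  have "block_of A ` block_starts A \<subseteq> block_of A ` A"
    by (auto simp: block_starts_def)
  moreover have "block_of A ` A \<subseteq> block_of A ` block_starts A"
    using block_start_exists by (metis image_subsetI image_eqI)
  ultimately show ?thesis
    unfolding blocks_eq_image by (rule equalityI[rotated])
qed

lemma inj_on_block_of: "inj_on (block_of A) (block_starts A)"
  by (metis Inf_block_of inj_onI)

lemma card_blocks: "card (blocks A) = card (block_starts A)"
  by (simp add: blocks_eq_starts card_image inj_on_block_of)

text \<open>Blocks correspond to their starts, which are their infima, so counting blocks by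
  \<open>Inf\<close> is counting starts. The definite description in \<open>nth_block\<close>
  thereby becomes a level set of \<open>block_rank\<close>.\<close>

lemma nth_block_eq:
  assumes "n \<in> A"
  shows "nth_block A (block_rank A n) = {m\<in>A. block_rank A m = block_rank A n}"
proof -
  have rank: "card {C\<in>blocks A. Inf C \<le> Inf (block_of A s)} = block_rank A s"
    if "s \<in> block_starts A" for s
  proof -
    have "{C\<in>blocks A. Inf C \<le> Inf (block_of A s)} = block_of A ` {t\<in>block_starts A. t \<le> s}"
      using that by (auto simp: blocks_eq_starts Inf_block_of)
    moreover have "inj_on (block_of A) {t\<in>block_starts A. t \<le> s}"
      by (rule inj_on_subset[OF inj_on_block_of]) auto
    ultimately show ?thesis
      by (simp add: card_image block_rank_def)
  qed
  obtain s where s: "s \<in> block_starts A" "block_of A s = block_of A n"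
    using block_start_exists[OF assms] by blast
  have rs: "block_rank A s = block_rank A n"
    using mem_block_of[OF assms] unfolding s(2)[symmetric] by (simp add: block_of_def)
  have "nth_block A (block_rank A n) = block_of A s"
    unfolding nth_block_def
  proof (rule the_equality)
    show "block_of A s \<in> blocks A \<and>
        card {C \<in> blocks A. Inf C \<le> Inf (block_of A s)} = block_rank A n"
      using s(1) rank[OF s(1)] rs by (simp add: blocks_eq_starts)
  next
    fix B assume B: "B \<in> blocks A \<and> card {C \<in> blocks A. Inf C \<le> Inf B} = block_rank A n"
    then obtain t where t: "t \<in> block_starts A" "B = block_of A t"
      unfolding blocks_eq_starts by blast
    then have "block_rank A t = block_rank A n"
      using rank[OF t(1)] B by simp
    then show "B = block_of A s"
      using rs t by (auto simp: block_of_def)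
  qed
  then show ?thesis
    using s(2) by (simp add: block_of_def)
qed

section \<open>Infinitely many blocks and sums over them\<close>

lemma infinite_block_starts:
  assumes "infinite A" "infinite (- A)"
  shows "infinite (block_starts A)"
  unfolding infinite_nat_iff_unbounded
proof
  fix m
  obtain l where l: "m < l" "l \<notin> A"
    using assms(2) unfolding infinite_nat_iff_unbounded by auto
  obtain n where n: "l < n" "n \<in> A"
    using assms(1) unfolding infinite_nat_iff_unbounded by auto
  obtain s where "s \<in> block_starts A" "l < s"
    using block_start_between[OF l(2) n(2) n(1)] by auto
  then show "\<exists>n>m. n \<in> block_starts A"
    using l(1) less_trans by blast
qed

lemma block_rank_unbounded:
  assumes "infinite A" "infinite (- A)"
  shows "\<exists>n. i \<le> block_rank A n"
proof (induction i)
  case (Suc i)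
  then obtain n where n: "i \<le> block_rank A n" by auto
  obtain s where s: "s \<in> block_starts A" "n < s"
    using infinite_block_starts[OF assms] unfolding infinite_nat_iff_unbounded by auto
  have "card {t\<in>block_starts A. n < t \<and> t \<le> s} \<noteq> 0"
    using s by (auto simp: card_eq_0_iff)
  then have "Suc i \<le> block_rank A s"
    using block_rank_split[of n s A] s n by linarith
  then show ?case ..
qed auto

text \<open>The rank climbs by at most one at a time, and only at points of \<open>A\<close>; so the
  first \<open>n\<close> where it reaches \<open>i\<close> lies in \<open>A\<close> and has exactly
  this rank.\<close>

lemma block_rank_surj:
  assumes "infinite A" "infinite (- A)" "0 < i"
  shows "\<exists>n\<in>A. block_rank A n = i"
proof -
  define n where "n = (LEAST n. i \<le> block_rank A n)"
  have n: "i \<le> block_rank A n"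
    unfolding n_def using LeastI_ex[OF block_rank_unbounded[OF assms(1,2)]] .
  show ?thesis
  proof (cases n)
    case 0
    then show ?thesis
      using n assms(3) by (intro bexI[of _ n]) (auto simp: block_rank_0 split: if_splits)
  next
    case (Suc m)
    have "\<not> i \<le> block_rank A m"
      using not_less_Least[of m "\<lambda>n. i \<le> block_rank A n"] Suc by (simp add: n_def)
    then show ?thesis
      using n Suc block_rank_Suc[of A m] by (intro bexI[of _ n]) (auto split: if_splits)
  qed
qed

lemma finite_block_rank_less:
  assumes "infinite A" "infinite (- A)"
  shows "finite {n\<in>A. block_rank A n < i}"
proof -
  obtain N where N: "i \<le> block_rank A N"
    using block_rank_unbounded[OF assms] by auto
  have "{n\<in>A. block_rank A n < i} \<subseteq> {..<N}"
  proof
    fix n assume "n \<in> {n\<in>A. block_rank A n < i}"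
    then have "\<not> N \<le> n"
      using block_rank_mono[of N n A] N by auto
    then show "n \<in> {..<N}" by simp
  qed
  then show ?thesis
    using finite_subset by blast
qed

text \<open>Blocks are numbered from 1, so this covers the first \<open>i - 1\<close> of
  them.\<close>

definition rank_sum :: "(nat \<Rightarrow> real) \<Rightarrow> nat set \<Rightarrow> nat \<Rightarrow> real" where
  "rank_sum a A i = sum a {n\<in>A. block_rank A n < i}"

text \<open>Sums over ranges of blocks telescope. Index 0 is excluded because no block carries this
  number.\<close>

lemma block_sum_eq_diff:
  assumes "infinite A" "infinite (- A)" "0 < i" "i \<le> Suc j"
  shows "block_sum a A i j = rank_sum a A (Suc j) - rank_sum a A i"
proof -
  have nb: "nth_block A m = {n\<in>A. block_rank A n = m}" if "0 < m" for m
    using block_rank_surj[OF assms(1,2) that] nth_block_eq by auto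
  have "(\<Union>m\<in>{i..j}. nth_block A m) = {n\<in>A. i \<le> block_rank A n \<and> block_rank A n \<le> j}"
    using nb assms(3) by auto
  also have "\<dots> = {n\<in>A. block_rank A n < Suc j} - {n\<in>A. block_rank A n < i}"
    by auto
  finally have *: "(\<Union>m\<in>{i..j}. nth_block A m) = \<dots>" .
  show ?thesis
    unfolding block_sum_def rank_sum_def *
    using assms finite_block_rank_less[OF assms(1,2)] by (intro sum_diff) auto
qed

subsection \<open>Initial parts of order-preserving rearrangements\<close>

definition sign_cut :: "nat set \<Rightarrow> nat \<Rightarrow> nat \<Rightarrow> nat set" where
  "sign_cut A x y = {m\<in>A. m < x} \<union> {m\<in>- A. m < y}"

lemma sign_cut_swap: "sign_cut (- A) y x = sign_cut A x y"
  by (auto simp: sign_cut_def)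

section \<open>The block number of a cut\<close>

definition ranks_within :: "nat set \<Rightarrow> nat \<Rightarrow> nat \<Rightarrow> nat \<Rightarrow> bool" where
  "ranks_within A M x y \<longleftrightarrow>
     block_rank A x \<le> block_rank A y + M \<and> block_rank A y \<le> block_rank A x + M"

text \<open>The cut consists of everything below \<open>x\<close> and, beyond \<open>x\<close>, of
  the elements of \<open>- A\<close> below \<open>y\<close>. So its block count differs by at most
  one from the number of blocks of \<open>- A\<close> that start between \<open>x\<close> and
  \<open>y\<close>.\<close>

lemma card_block_starts_cut_less:
  assumes "x \<in> A" "y \<notin> A" "x < y"
  shows "card (block_starts (sign_cut A x y)) \<le> block_rank (- A) y - block_rank (- A) x + 1"
    and "block_rank (- A) y - block_rank (- A) x \<le> card (block_starts (sign_cut A x y)) + 1"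
proof -
  let ?I = "{s\<in>block_starts (- A). x < s \<and> s \<le> y}"
  have card: "card ?I = block_rank (- A) y - block_rank (- A) x"
    using block_rank_split[of x y "- A"] assms by simp
  have fin: "finite (block_starts (sign_cut A x y))"
    by (rule finite_subset[of _ "{..<max x y}"]) (auto simp: block_starts_def sign_cut_def)
  \<comment> \<open>The extra 0 accounts for the full segment below \<open>x\<close>.\<close>
  have "block_starts (sign_cut A x y) \<subseteq> insert 0 ?I"
  proof
    fix s assume s: "s \<in> block_starts (sign_cut A x y)"
    show "s \<in> insert 0 ?I"
    proof (cases s)
      case (Suc m)
      have sc: "s \<in> sign_cut A x y" "m \<notin> sign_cut A x y"
        using s Suc by (auto simp: block_starts_def)
      then have "x \<le> m"
        using Suc assms by (auto simp: sign_cut_def)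
      then have "s \<notin> A" "s < y" "m \<in> A" "x < s"
        using sc Suc by (auto simp: sign_cut_def)
      then show ?thesis
        using Suc by (auto simp: block_starts_def)
    qed simp
  qed
  then have "card (block_starts (sign_cut A x y)) \<le> card (insert 0 ?I)"
    by (intro card_mono) auto
  also have "\<dots> \<le> card ?I + 1"
    by (simp add: card_insert_if)
  finally show "card (block_starts (sign_cut A x y)) \<le> block_rank (- A) y - block_rank (- A) x + 1"
    using card by simp
  \<comment> \<open>\<open>y\<close> may start a block of \<open>- A\<close>, but the cut stops
    before it.\<close>
  have "?I \<subseteq> insert y (block_starts (sign_cut A x y))"
    by (auto simp: block_starts_def sign_cut_def)
  then have "card ?I \<le> card (insert y (block_starts (sign_cut A x y)))"
    using fin by (intro card_mono) auto
  also have "\<dots> \<le> card (block_starts (sign_cut A x y)) + 1"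
    using fin by (simp add: card_insert_if)
  finally show "block_rank (- A) y - block_rank (- A) x \<le> card (block_starts (sign_cut A x y)) + 1"
    using card by simp
qed

text \<open>The slack 3 is one from counting in the cut plus, if \<open>x < y\<close>, one at each
  of \<open>x\<close> and \<open>y\<close> for passing from ranks in \<open>- A\<close> to ranks in
  \<open>A\<close>.\<close>

lemma block_starts_cut_iff:
  assumes "x \<in> A" "y \<notin> A"
  shows "card (block_starts (sign_cut A x y)) \<le> M \<Longrightarrow> ranks_within A (M + 3) x y"
    and "ranks_within A M x y \<Longrightarrow> card (block_starts (sign_cut A x y)) \<le> M + 3"
proof -
  have "x < y \<or> y < x"
    using assms by (metis nat_neq_iff)
  then have "(card (block_starts (sign_cut A x y)) \<le> M \<longrightarrow> ranks_within A (M + 3) x y) \<and>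
      (ranks_within A M x y \<longrightarrow> card (block_starts (sign_cut A x y)) \<le> M + 3)"
  proof
    assume "x < y"
    then show ?thesis
      using card_block_starts_cut_less[OF assms] block_rank_Compl[of A x] block_rank_Compl[of A y]
        block_rank_mono[of x y A] block_rank_mono[of x y "- A"]
      unfolding ranks_within_def by linarith
  next
    assume "y < x"
    then have "card (block_starts (sign_cut A x y)) \<le> block_rank A x - block_rank A y + 1"
      "block_rank A x - block_rank A y \<le> card (block_starts (sign_cut A x y)) + 1"
      "block_rank A y \<le> block_rank A x"
      using card_block_starts_cut_less[of y "- A" x] assms block_rank_mono[of y x A]
      by (simp_all add: sign_cut_swap)
    then show ?thesis
      unfolding ranks_within_def by linarith
  qed
  then show "card (block_starts (sign_cut A x y)) \<le> M \<Longrightarrow> ranks_within A (M + 3) x y"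
    and "ranks_within A M x y \<Longrightarrow> card (block_starts (sign_cut A x y)) \<le> M + 3"
    by blast+
qed

section \<open>Initial parts of permutations that keep the order on both sides\<close>

definition keeps_order :: "nat set \<Rightarrow> (nat \<Rightarrow> nat) \<Rightarrow> bool" where
  "keeps_order A \<sigma> \<longleftrightarrow> (\<forall>i j. \<sigma> i < \<sigma> j \<and> (\<sigma> i \<in> A \<longleftrightarrow> \<sigma> j \<in> A) \<longrightarrow> i < j)"

text \<open>Type R with bounded block number, without the convergence. This is symmetric in
  \<open>A\<close> and \<open>- A\<close>, so arguments about one sign transfer to the
  other.\<close>

definition tame_perm :: "nat set \<Rightarrow> (nat \<Rightarrow> nat) \<Rightarrow> bool" where
  "tame_perm A \<sigma> \<longleftrightarrow> bij \<sigma> \<and> keeps_order A \<sigma> \<and> bounded_block_number \<sigma>"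

lemma tame_perm_Compl: "tame_perm (- A) \<sigma> \<longleftrightarrow> tame_perm A \<sigma>"
  by (auto simp: tame_perm_def keeps_order_def)

text \<open>A smaller index of the same side is used earlier, so an initial part meets each side in
  an initial segment of that side.\<close>

lemma initial_part_down_closed:
  assumes "bij \<sigma>" "keeps_order A \<sigma>" "m \<in> \<sigma> ` {..<n}" "l < m" "l \<in> A \<longleftrightarrow> m \<in> A"
  shows "l \<in> \<sigma> ` {..<n}"
proof -
  obtain j where j: "m = \<sigma> j" "j < n"
    using assms(3) by auto
  obtain i where i: "l = \<sigma> i"
    using assms(1) by (metis bij_pointE)
  have "i < j"
    using assms(2,4,5) unfolding i j(1) keeps_order_def by auto
  then show ?thesis
    using i j by auto
qed

lemma initial_part_side:
  assumes "bij \<sigma>" "keeps_order A \<sigma>" "x \<in> A" "x \<notin> \<sigma> ` {..<n}"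
    and "\<And>m. m \<in> A \<Longrightarrow> m < x \<Longrightarrow> m \<in> \<sigma> ` {..<n}"
  shows "\<sigma> ` {..<n} \<inter> A = {m\<in>A. m < x}"
proof -
  have "m < x" if "m \<in> \<sigma> ` {..<n}" "m \<in> A" for m
    using initial_part_down_closed[OF assms(1,2) that(1), of x] assms(3,4) that
    by (metis linorder_neqE_nat)
  then show ?thesis
    using assms(5) by blast
qed

lemma initial_part_first_missing:
  assumes "bij \<sigma>" "keeps_order A \<sigma>" "infinite A"
  shows "\<exists>x\<in>A. \<sigma> ` {..<n} \<inter> A = {m\<in>A. m < x}"
proof -
  have "infinite (A - \<sigma> ` {..<n})"
    using assms(3) by (simp add: Diff_infinite_finite)
  then have ex: "\<exists>x. x \<in> A - \<sigma> ` {..<n}"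
    using infinite_imp_nonempty by blast
  define x where "x = (LEAST x. x \<in> A - \<sigma> ` {..<n})"
  have x: "x \<in> A" "x \<notin> \<sigma> ` {..<n}"
    using LeastI_ex[OF ex] by (auto simp: x_def)
  have "m \<in> \<sigma> ` {..<n}" if "m \<in> A" "m < x" for m
    using not_less_Least[of m "\<lambda>x. x \<in> A - \<sigma> ` {..<n}"] that by (auto simp: x_def)
  then show ?thesis
    using initial_part_side[OF assms(1,2) x] x by blast
qed

lemma initial_part_upto:
  assumes "bij \<sigma>" "keeps_order A \<sigma>" "\<sigma> n \<in> A"
  shows "\<sigma> ` {..<n} \<inter> A = {m\<in>A. m < \<sigma> n}"
proof (rule initial_part_side[OF assms])
  have "inj \<sigma>"
    using assms(1) by (simp add: bij_is_inj)
  then show "\<sigma> n \<notin> \<sigma> ` {..<n}"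
    by (auto dest: injD)
next
  fix m assume m: "m \<in> A" "m < \<sigma> n"
  obtain i where i: "m = \<sigma> i"
    using assms(1) by (metis bij_pointE)
  have "i < n"
    using assms m i unfolding keeps_order_def by blast
  then show "m \<in> \<sigma> ` {..<n}"
    using i by auto
qed

lemma keeps_order_Compl: "keeps_order (- A) \<sigma> \<longleftrightarrow> keeps_order A \<sigma>"
  by (auto simp: keeps_order_def)

lemma sign_cutI:
  assumes "F \<inter> A = {m\<in>A. m < x}" "F \<inter> - A = {m\<in>- A. m < y}"
  shows "F = sign_cut A x y"
  unfolding sign_cut_def assms[symmetric] by blast

lemma initial_part_sign_cut:
  assumes "bij \<sigma>" "keeps_order A \<sigma>" "infinite A" "infinite (- A)"
  shows "\<exists>x y. x \<in> A \<and> y \<notin> A \<and> \<sigma> ` {..<n} = sign_cut A x y"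
proof -
  obtain x where x: "x \<in> A" "\<sigma> ` {..<n} \<inter> A = {m\<in>A. m < x}"
    using initial_part_first_missing[OF assms(1-3)] by blast
  obtain y where y: "y \<in> - A" "\<sigma> ` {..<n} \<inter> - A = {m\<in>- A. m < y}"
    using initial_part_first_missing[OF assms(1) _ assms(4)] assms(2) keeps_order_Compl by blast
  show ?thesis
    using x(1) y(1) sign_cutI[OF x(2) y(2)] by blast
qed

text \<open>Stopping just before a chosen index outside \<open>A\<close> makes this index the second
  bound of the cut. Two rearrangements can then be compared at the same place.\<close>

lemma initial_part_sign_cut_at:
  assumes "bij \<sigma>" "keeps_order A \<sigma>" "infinite A" "\<sigma> n \<notin> A"
  shows "\<exists>x\<in>A. \<sigma> ` {..<n} = sign_cut A x (\<sigma> n)"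
proof -
  obtain x where x: "x \<in> A" "\<sigma> ` {..<n} \<inter> A = {m\<in>A. m < x}"
    using initial_part_first_missing[OF assms(1-3)] by blast
  have y: "\<sigma> ` {..<n} \<inter> - A = {m\<in>- A. m < \<sigma> n}"
    using initial_part_upto[of \<sigma> "- A" n] assms keeps_order_Compl by blast
  show ?thesis
    using x(1) sign_cutI[OF x(2) y] by blast
qed

text \<open>Every initial part is a cut, and the block count of a cut is the rank distance of its
  bounds up to a constant. In this form block numbers can be controlled through sums over
  blocks.\<close>

lemma bounded_block_number_iff:
  assumes "bij \<sigma>" "keeps_order A \<sigma>" "infinite A" "infinite (- A)"
  shows "bounded_block_number \<sigma> \<longleftrightarrow>
    (\<exists>M. \<forall>n x y. x \<in> A \<and> y \<notin> A \<and> \<sigma> ` {..<n} = sign_cut A x y \<longrightarrow> ranks_within A M x y)"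
proof
  assume "bounded_block_number \<sigma>"
  then obtain M where M: "\<And>n. card (block_starts (\<sigma> ` {0..n})) \<le> M"
    unfolding bounded_block_number_def block_number_def card_blocks by auto
  \<comment> \<open>\<open>block_number\<close> starts with one value already used, whereas
    \<open>{..<n}\<close> may be empty.\<close>
  have "card (block_starts (\<sigma> ` {..<n})) \<le> M" for n
  proof (cases n)
    case 0
    then show ?thesis
      by (simp add: block_starts_def)
  next
    case (Suc k)
    then show ?thesis
      using M[of k] by (simp add: lessThan_Suc_atMost atMost_atLeast0)
  qed
  then have "ranks_within A (M + 3) x y"
    if "x \<in> A" "y \<notin> A" "\<sigma> ` {..<n} = sign_cut A x y" for n x y
    using block_starts_cut_iff(1)[OF that(1,2)] that(3) by metis
  then show "\<exists>M. \<forall>n x y. x \<in> A \<and> y \<notin> A \<and> \<sigma> ` {..<n} = sign_cut A x y \<longrightarrow> ranks_within A M x y"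
    by blast
next
  assume "\<exists>M. \<forall>n x y. x \<in> A \<and> y \<notin> A \<and> \<sigma> ` {..<n} = sign_cut A x y \<longrightarrow> ranks_within A M x y"
  then obtain M where
    M: "\<And>n x y. x \<in> A \<Longrightarrow> y \<notin> A \<Longrightarrow> \<sigma> ` {..<n} = sign_cut A x y \<Longrightarrow> ranks_within A M x y"
    by blast
  have "block_number \<sigma> n \<le> M + 3" for n
  proof -
    obtain x y where xy: "x \<in> A" "y \<notin> A" "\<sigma> ` {..<Suc n} = sign_cut A x y"
      using initial_part_sign_cut[OF assms] by blast
    then show ?thesis
      using block_starts_cut_iff(2)[OF xy(1,2) M[OF xy]]
      by (simp add: block_number_def card_blocks lessThan_Suc_atMost flip: atMost_atLeast0)
  qed
  then show "bounded_block_number \<sigma>"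
    unfolding bounded_block_number_def by blast
qed

section \<open>Partial sums split between the two sides\<close>

definition side_sum :: "(nat \<Rightarrow> real) \<Rightarrow> nat set \<Rightarrow> nat \<Rightarrow> real" where
  "side_sum a A x = sum a {m\<in>A. m < x}"

lemma sum_sign_cut: "sum a (sign_cut A x y) = side_sum a A x + side_sum a (- A) y"
  unfolding sign_cut_def side_sum_def by (rule sum.union_disjoint) auto

lemma partial_sum_sign_cut:
  assumes "inj \<sigma>" "\<sigma> ` {..<n} = sign_cut A x y"
  shows "(\<Sum>i<n. a (\<sigma> i)) = side_sum a A x + side_sum a (- A) y"
  using sum.reindex[of \<sigma> "{..<n}" a] inj_on_subset[OF assms(1)] assms(2)
  by (simp add: sum_sign_cut)

text \<open>Common form of \<open>ST_P\<close> and \<open>ST_N\<close>; the latter is this property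
  of \<open>\<lambda>n. - a n\<close> on the nonpositive indices.\<close>

definition substantial :: "(nat \<Rightarrow> real) \<Rightarrow> nat set \<Rightarrow> bool" where
  "substantial a A \<longleftrightarrow> (\<exists>k. \<exists>\<epsilon>>0. \<exists>i0. \<forall>i>i0. \<epsilon> \<le> block_sum a A i (i + k))"

subsection \<open>Greedy rearrangements\<close>

text \<open>Plain recursion on the set \<open>F n\<close> of values used so far yields the
  sequence.\<close>

lemma history_recursion:
  fixes g :: "'a set \<Rightarrow> 'a"
  shows "\<exists>\<tau> :: nat \<Rightarrow> 'a. \<forall>n. \<tau> n = g (\<tau> ` {..<n})"
proof -
  define F where "F = rec_nat {} (\<lambda>_ X. insert (g X) X)"
  have "F n = (\<lambda>n. g (F n)) ` {..<n}" for n
    by (induction n) (auto simp: F_def lessThan_Suc)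
  then show ?thesis
    by (intro exI[of _ "\<lambda>n. g (F n)"]) metis
qed

text \<open>If some \<open>m\<close> in \<open>B\<close> were never picked, every pick from
  \<open>B\<close> would be at most \<open>m\<close>, and injectivity allows only finitely many of
  these.\<close>

lemma picks_least_covers:
  fixes \<tau> :: "nat \<Rightarrow> nat"
  assumes "inj \<tau>" "\<And>j m. \<tau> j \<in> B \<Longrightarrow> m \<in> B \<Longrightarrow> m \<notin> \<tau> ` {..<j} \<Longrightarrow> \<tau> j \<le> m"
    and "infinite {j. \<tau> j \<in> B}"
  shows "B \<subseteq> range \<tau>"
proof
  fix m assume m: "m \<in> B"
  show "m \<in> range \<tau>"
  proof (rule ccontr)
    assume "m \<notin> range \<tau>"
    then have "m \<notin> \<tau> ` {..<j}" for j
      by auto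
    then have "\<tau> ` {j. \<tau> j \<in> B} \<subseteq> {..m}"
      using assms(2) m by blast
    then have "finite (\<tau> ` {j. \<tau> j \<in> B})"
      using finite_subset by blast
    then show False
      using assms(1,3) finite_imageD inj_on_subset[OF assms(1) subset_UNIV] by blast
  qed
qed

text \<open>Almost all picks come from \<open>B\<close>, so \<open>B\<close> gets used up, and its
  unbounded sums outweigh the finitely many other terms. This shows later that the greedy
  rearrangement visits both sides of its target infinitely often.\<close>

lemma picks_least_diverges:
  fixes \<tau> :: "nat \<Rightarrow> nat" and a :: "nat \<Rightarrow> real"
  assumes "inj \<tau>" "\<And>j m. \<tau> j \<in> B \<Longrightarrow> m \<in> B \<Longrightarrow> m \<notin> \<tau> ` {..<j} \<Longrightarrow> \<tau> j \<le> m"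
    and "finite {j. \<tau> j \<notin> B}" "\<And>n. n \<in> B \<Longrightarrow> a n \<le> 0" "\<And>C. \<exists>y. side_sum a B y < C"
  shows "\<exists>n0. \<forall>n\<ge>n0. (\<Sum>i<n. a (\<tau> i)) < C"
proof -
  have "UNIV - {j. \<tau> j \<notin> B} = {j. \<tau> j \<in> B}"
    by auto
  then have "infinite {j. \<tau> j \<in> B}"
    using Diff_infinite_finite[OF assms(3) infinite_UNIV_nat] by simp
  then have cover: "B \<subseteq> range \<tau>"
    using picks_least_covers[OF assms(1,2)] by blast
  define D where "D = \<tau> ` {j. \<tau> j \<notin> B}"
  have finD: "finite D"
    using assms(3) by (simp add: D_def)
  \<comment> \<open>\<open>C\<close> is lowered by the most that the terms outside \<open>B\<close>
    can add.\<close>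
  obtain y where y: "side_sum a B y < C - (\<Sum>m\<in>D. \<bar>a m\<bar>)"
    using assms(5) by blast
  have "\<exists>J. finite J \<and> {m\<in>B. m < y} = \<tau> ` J"
    using finite_subset_image[of "{m\<in>B. m < y}" \<tau> UNIV] cover by auto
  then obtain J where J: "finite J" "{m\<in>B. m < y} = \<tau> ` J"
    by blast
  obtain n0 where n0: "\<And>j. j \<in> J \<Longrightarrow> j < n0"
    using J(1) finite_nat_set_iff_bounded by auto
  have "(\<Sum>i<n. a (\<tau> i)) < C" if "n0 \<le> n" for n
  proof -
    let ?T = "\<tau> ` {..<n}"
    have "(\<Sum>i<n. a (\<tau> i)) = sum a ?T"
      using sum.reindex[of \<tau> "{..<n}" a] inj_on_subset[OF assms(1)] by simp
    also have "\<dots> = sum a (?T \<inter> B) + sum a (?T - B)"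
      by (simp add: sum.Int_Diff)
    also have "sum a (?T - B) \<le> (\<Sum>m\<in>?T - B. \<bar>a m\<bar>)"
      by (rule sum_mono) simp
    also have "\<dots> \<le> (\<Sum>m\<in>D. \<bar>a m\<bar>)"
      by (rule sum_mono2[OF finD]) (auto simp: D_def)
    \<comment> \<open>From \<open>n0\<close> on all terms of \<open>B\<close> below \<open>y\<close>
      are present, and further terms of \<open>B\<close> cannot raise the sum.\<close>
    also have "sum a (?T \<inter> B) \<le> side_sum a B y"
    proof -
      have "{m\<in>B. m < y} \<subseteq> ?T"
        unfolding J(2) using n0 that by fastforce
      then have "(\<Sum>m\<in>{m\<in>B. m < y}. - a m) \<le> (\<Sum>m\<in>?T \<inter> B. - a m)"
        by (intro sum_mono2) (auto simp: assms(4))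
      then show ?thesis
        by (simp add: side_sum_def sum_negf)
    qed
    finally show ?thesis
      using y by simp
  qed
  then show ?thesis by blast
qed

text \<open>Only finitely many indices carry values of size at least \<open>e\<close>, and an
  injection meets each of them at most once.\<close>

lemma tendsto_0_rearrange:
  fixes f :: "nat \<Rightarrow> real"
  assumes "(\<lambda>n. f (\<sigma> n)) \<longlonglongrightarrow> 0" "surj \<sigma>" "inj \<tau>"
  shows "(\<lambda>n. f (\<tau> n)) \<longlonglongrightarrow> 0"
proof (rule LIMSEQ_I)
  fix e :: real assume "0 < e"
  then obtain N where N: "\<And>n. N \<le> n \<Longrightarrow> norm (f (\<sigma> n) - 0) < e"
    using LIMSEQ_D[OF assms(1)] by blast
  have "{m. e \<le> \<bar>f m\<bar>} \<subseteq> \<sigma> ` {..<N}"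
  proof
    fix m assume m: "m \<in> {m. e \<le> \<bar>f m\<bar>}"
    obtain n where n: "m = \<sigma> n"
      using assms(2) by (metis surjE)
    then have "n < N"
      using N[of n] m by (auto simp: not_le[symmetric])
    then show "m \<in> \<sigma> ` {..<N}"
      using n by auto
  qed
  then have "finite {m. e \<le> \<bar>f m\<bar>}"
    using finite_subset by blast
  then have "finite (\<tau> -` {m. e \<le> \<bar>f m\<bar>})"
    using assms(3) by (rule finite_vimageI)
  then obtain n0 where "\<forall>n\<in>\<tau> -` {m. e \<le> \<bar>f m\<bar>}. n < n0"
    using finite_nat_set_iff_bounded by blast
  then show "\<exists>n0. \<forall>n\<ge>n0. norm (f (\<tau> n) - 0) < e"
    by (intro exI[of _ n0]) (auto simp: not_le[symmetric])
qed

lemma partial_sums_bounded: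
  fixes f :: "nat \<Rightarrow> real"
  assumes "summable f"
  obtains C where "\<And>n. \<bar>\<Sum>i<n. f i\<bar> \<le> C"
proof -
  have "Bseq (\<lambda>n. \<Sum>i<n. f i)"
    using assms by (intro convergent_imp_Bseq) (simp add: summable_iff_convergent)
  then show thesis
    using that by (auto simp: Bseq_def)
qed

text \<open>Once the steps are smaller than \<open>e\<close> and the level \<open>r\<close> is crossed, the walk stays \<open>e\<close>-close to it.\<close>

lemma steered_walk_converges:
  fixes S :: "nat \<Rightarrow> real"
  assumes "(\<lambda>n. S (Suc n) - S n) \<longlonglongrightarrow> 0"
    and up: "\<And>n. S n \<le> r \<Longrightarrow> S n \<le> S (Suc n)" and down: "\<And>n. r < S n \<Longrightarrow> S (Suc n) \<le> S n"
    and "infinite {n. S n \<le> r}" "infinite {n. r < S n}"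
  shows "S \<longlonglongrightarrow> r"
proof (rule LIMSEQ_I)
  fix e :: real assume "0 < e"
  then obtain N where N: "\<And>n. N \<le> n \<Longrightarrow> \<bar>S (Suc n) - S n\<bar> < e"
    using LIMSEQ_D[OF assms(1)] by auto
  obtain n1 where n1: "N < n1" "S n1 \<le> r"
    using assms(4) unfolding infinite_nat_iff_unbounded by auto
  obtain n2 where n2: "n1 < n2" "r < S n2"
    using assms(5) unfolding infinite_nat_iff_unbounded by auto
  \<comment> \<open>The walk is at most \<open>r\<close> at \<open>n1\<close> and above
    \<open>r\<close> at \<open>n2\<close>; if it always kept distance \<open>e\<close> from
    \<open>r\<close>, steps shorter than \<open>e\<close> could not take it across.\<close>
  have "\<exists>n\<ge>N. \<bar>S n - r\<bar> < e"
  proof (rule ccontr)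
    assume no: "\<not> ?thesis"
    have "S n \<le> r" if "n1 \<le> n" for n
      using that
    proof (induction n rule: dec_induct)
      case (step n)
      have "\<not> \<bar>S n - r\<bar> < e" "\<bar>S (Suc n) - S n\<bar> < e"
        using no N[of n] step(1) n1 by (auto dest!: spec[of _ n])
      then show ?case
        using step.IH by linarith
    qed (use n1 in simp)
    then show False
      using n2 by (meson less_imp_le not_less)
  qed
  then obtain n0 where n0: "N \<le> n0" "\<bar>S n0 - r\<bar> < e"
    by blast
  have "\<bar>S n - r\<bar> < e" if "n0 \<le> n" for n
    using that
  proof (induction n rule: dec_induct)
    case (step n)
    have "\<bar>S (Suc n) - S n\<bar> < e"
      using N step n0 by auto
    then show ?case
      using step.IH up[of n] down[of n] by linarith
  qed (use n0 in simp)
  then show "\<exists>n0. \<forall>n\<ge>n0. norm (S n - r) < e"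
    by auto
qed

subsection \<open>Series split into a nonnegative and a nonpositive part\<close>

text \<open>Stated for a set \<open>A\<close> instead of the positive indices, so that it applies to
  \<open>a\<close> and, with the sides exchanged, to \<open>\<lambda>n. - a n\<close>.\<close>

locale signed_series =
  fixes a :: "nat \<Rightarrow> real" and A :: "nat set"
  assumes inf: "infinite A" "infinite (- A)"
    and nonneg: "\<And>n. n \<in> A \<Longrightarrow> 0 \<le> a n"
    and nonpos: "\<And>n. n \<notin> A \<Longrightarrow> a n \<le> 0"
begin

text \<open>An index of rank below that of \<open>x\<close> lies below \<open>x\<close>. The
  companion upper bound has \<open>Suc\<close> because the block with the rank of \<open>x\<close>
  may lie partly or wholly below \<open>x\<close>.\<close>

lemma rank_sum_le_side_sum: "rank_sum a A (block_rank A x) \<le> side_sum a A x"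
  unfolding rank_sum_def side_sum_def
proof (rule sum_mono2)
  show "{n \<in> A. block_rank A n < block_rank A x} \<subseteq> {m \<in> A. m < x}"
    using block_rank_mono[of x _ A] by (auto simp: not_less[symmetric])
qed (auto simp: nonneg)

lemma side_sum_le_rank_sum: "side_sum a A x \<le> rank_sum a A (Suc (block_rank A x))"
  unfolding rank_sum_def side_sum_def
proof (rule sum_mono2)
  show "{m \<in> A. m < x} \<subseteq> {n \<in> A. block_rank A n < Suc (block_rank A x)}"
    using block_rank_mono[of _ x A] by (auto simp: less_Suc_eq_le)
qed (auto simp: nonneg finite_block_rank_less[OF inf])

lemma rank_sum_mono: "i \<le> j \<Longrightarrow> rank_sum a A i \<le> rank_sum a A j"
  unfolding rank_sum_def
  by (rule sum_mono2) (auto simp: nonneg finite_block_rank_less[OF inf])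

text \<open>The cut is taken just before \<open>\<sigma>\<close> takes \<open>y\<close>, so its
  bound in \<open>- A\<close> is \<open>y\<close> whatever the permutation; \<open>M\<close> does
  not depend on \<open>y\<close>.\<close>

lemma tame_perm_cut_at:
  assumes "tame_perm A \<sigma>"
  obtains M where "\<And>y. y \<notin> A \<Longrightarrow> \<exists>n x. \<sigma> n = y \<and> x \<in> A \<and> ranks_within A M x y \<and>
      (\<Sum>i<n. a (\<sigma> i)) = side_sum a A x + side_sum a (- A) y"
proof -
  have \<sigma>: "bij \<sigma>" "keeps_order A \<sigma>" "inj \<sigma>"
    using assms by (auto simp: tame_perm_def bij_is_inj)
  obtain M where M:
    "\<And>n x y. x \<in> A \<Longrightarrow> y \<notin> A \<Longrightarrow> \<sigma> ` {..<n} = sign_cut A x y \<Longrightarrow> ranks_within A M x y"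
    using assms bounded_block_number_iff[OF \<sigma>(1,2) inf] unfolding tame_perm_def by blast
  have "\<exists>n x. \<sigma> n = y \<and> x \<in> A \<and> ranks_within A M x y \<and>
      (\<Sum>i<n. a (\<sigma> i)) = side_sum a A x + side_sum a (- A) y" if "y \<notin> A" for y
  proof -
    obtain n where n: "\<sigma> n = y"
      using \<sigma>(1) by (metis bij_pointE)
    then obtain x where x: "x \<in> A" "\<sigma> ` {..<n} = sign_cut A x y"
      using initial_part_sign_cut_at[OF \<sigma>(1,2) inf(1), of n] \<open>y \<notin> A\<close> by auto
    then show ?thesis
      using n M[OF x(1) that x(2)] partial_sum_sign_cut[OF \<sigma>(3) x(2)] by blast
  qed
  then show thesis
    by (rule that)
qed

text \<open>
  If the block sums over \<open>A\<close> are not substantial, there are arbitrarily long stretches of blocks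
  on which \<open>A\<close> contributes almost nothing. Stopping both rearrangements just before the same
  element of \<open>- A\<close> in the middle of such a stretch gives almost equal partial sums.
\<close>

lemma sums_unique_if_not_substantial:
  assumes "\<not> substantial a A" "tame_perm A \<sigma>" "tame_perm A \<tau>"
    and "(\<lambda>n. a (\<sigma> n)) sums r" "(\<lambda>n. a (\<tau> n)) sums s"
  shows "r = s"
proof -
  obtain M1 where M1: "\<And>y. y \<notin> A \<Longrightarrow> \<exists>n x. \<sigma> n = y \<and> x \<in> A \<and> ranks_within A M1 x y \<and>
      (\<Sum>i<n. a (\<sigma> i)) = side_sum a A x + side_sum a (- A) y"
    by (rule tame_perm_cut_at[OF assms(2)]) blast
  obtain M2 where M2: "\<And>y. y \<notin> A \<Longrightarrow> \<exists>n x. \<tau> n = y \<and> x \<in> A \<and> ranks_within A M2 x y \<and>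
      (\<Sum>i<n. a (\<tau> i)) = side_sum a A x + side_sum a (- A) y"
    by (rule tame_perm_cut_at[OF assms(3)]) blast
  define M where "M = max M1 M2"
  have "\<bar>r - s\<bar> \<le> e" if "0 < e" for e
  proof -
    have e3: "0 < e / 3"
      using that by simp
    obtain n1 where n1: "\<And>n. n1 \<le> n \<Longrightarrow> norm ((\<Sum>i<n. a (\<sigma> i)) - r) < e / 3"
      using LIMSEQ_D[OF assms(4)[unfolded sums_def] e3] by auto
    obtain n2 where n2: "\<And>n. n2 \<le> n \<Longrightarrow> norm ((\<Sum>i<n. a (\<tau> i)) - s) < e / 3"
      using LIMSEQ_D[OF assms(5)[unfolded sums_def] e3] by auto
    \<comment> \<open>Indices from \<open>B\<close> on are taken only at positions where the partial
      sums are already within \<open>e / 3\<close> of their limits.\<close>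
    obtain B where B: "\<And>j. j < n1 \<Longrightarrow> \<sigma> j < B" "\<And>j. j < n2 \<Longrightarrow> \<tau> j < B"
    proof -
      have "finite (\<sigma> ` {..<n1} \<union> \<tau> ` {..<n2})"
        by simp
      then obtain B where "\<forall>x\<in>\<sigma> ` {..<n1} \<union> \<tau> ` {..<n2}. x < B"
        using finite_nat_set_iff_bounded by metis
      then show thesis
        by (intro that) auto
    qed
    \<comment> \<open>The stretch of \<open>2 * M + 1\<close> blocks leaves room for deviations by
      \<open>M\<close> either way from the middle rank \<open>i + M\<close>; \<open>i\<close> beyond
      \<open>Suc B\<close> puts it past \<open>B\<close>.\<close>
    obtain i where i: "Suc B < i" "block_sum a A i (i + 2 * M) < e / 3"
      using assms(1) e3 unfolding substantial_def by (meson not_le)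
    \<comment> \<open>\<open>y\<close> is the first index after block \<open>i + M\<close>, the
      middle of the stretch.\<close>
    obtain y where y: "y \<notin> A" "block_rank A y = i + M"
    proof -
      obtain z where z: "z \<in> A" "block_rank A z = i + M"
        using block_rank_surj[OF inf, of "i + M"] i by auto
      define y where "y = (LEAST y. z < y \<and> y \<notin> A)"
      have ex: "\<exists>y>z. y \<notin> A"
        using inf(2) unfolding infinite_nat_iff_unbounded by auto
      have y: "z < y" "y \<notin> A"
        using LeastI_ex[of "\<lambda>y. z < y \<and> y \<notin> A"] ex by (auto simp: y_def)
      have "{z..y - 1} \<subseteq> A"
      proof
        fix m assume m: "m \<in> {z..y - 1}"
        then have "m < y"
          using y by auto
        then show "m \<in> A"
          using not_less_Least[of m "\<lambda>y. z < y \<and> y \<notin> A"] m z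
          by (cases "m = z") (auto simp: y_def)
      qed
      moreover have "y - 1 \<in> A"
        using calculation y by auto
      ultimately have "block_rank A (y - 1) = i + M"
        using block_rank_eq_iff[of z "y - 1" A] y z by auto
      then have "block_rank A y = i + M"
        using block_rank_Suc[of A "y - 1"] y by auto
      then show thesis
        using y that by blast
    qed
    have B_less: "B < y"
      using block_rank_le_Suc[of A y] y i by simp
    obtain n x where nx: "\<sigma> n = y" "x \<in> A" "ranks_within A M1 x y"
      "(\<Sum>i<n. a (\<sigma> i)) = side_sum a A x + side_sum a (- A) y"
      using M1[OF y(1)] by blast
    obtain m z where mz: "\<tau> m = y" "z \<in> A" "ranks_within A M2 z y"
      "(\<Sum>i<m. a (\<tau> i)) = side_sum a A z + side_sum a (- A) y"
      using M2[OF y(1)] by blast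
    \<comment> \<open>The bound of either cut has its rank inside the stretch, which confines its
      sum to an interval whose length is the block sum below \<open>e / 3\<close>.\<close>
    have thin: "rank_sum a A i \<le> side_sum a A w \<and> side_sum a A w \<le> rank_sum a A (Suc (i + 2 * M))"
      if "ranks_within A M w y" for w
    proof -
      have "i \<le> block_rank A w" "Suc (block_rank A w) \<le> Suc (i + 2 * M)"
        using that y by (auto simp: ranks_within_def)
      then show ?thesis
        using rank_sum_mono rank_sum_le_side_sum[of w] side_sum_le_rank_sum[of w] order_trans
        by meson
    qed
    have "ranks_within A M x y" "ranks_within A M z y"
      using nx(3) mz(3) by (auto simp: ranks_within_def M_def)
    then have "\<bar>(\<Sum>i<n. a (\<sigma> i)) - (\<Sum>i<m. a (\<tau> i))\<bar> < e / 3"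
      using thin[of x] thin[of z] i block_sum_eq_diff[OF inf, of i "i + 2 * M" a] nx(4) mz(4)
      unfolding abs_less_iff by auto
    moreover have "n1 \<le> n" "n2 \<le> m"
      using B(1)[of n] B(2)[of m] B_less nx(1) mz(1) by (auto simp: not_less[symmetric])
    ultimately show ?thesis
      using n1[of n] n2[of m] by (simp add: abs_if split: if_splits)
  qed
  then have "\<bar>r - s\<bar> \<le> 0"
    by (rule field_le_epsilon) simp
  then show ?thesis by simp
qed

text \<open>Late enough, any \<open>k + 1\<close> consecutive blocks add at least
  \<open>\<epsilon>\<close>, so a bounded excess in the sum leaves room only for a bounded excess in
  rank.\<close>

lemma rank_gap:
  assumes "substantial a A"
  obtains K where "\<And>x z. side_sum a A x \<le> side_sum a A z + C \<Longrightarrow> block_rank A x \<le> block_rank A z + K"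
proof -
  obtain k \<epsilon> i0 where "0 < \<epsilon>" and st: "\<And>i. i0 < i \<Longrightarrow> \<epsilon> \<le> block_sum a A i (i + k)"
    using assms unfolding substantial_def by blast
  have step: "rank_sum a A i + \<epsilon> \<le> rank_sum a A (i + Suc k)" if "i0 < i" for i
    using st[OF that] block_sum_eq_diff[OF inf, of i "i + k" a] that by auto
  have steps: "rank_sum a A i + real L * \<epsilon> \<le> rank_sum a A (i + L * Suc k)" if "i0 < i" for i L
  proof (induction L)
    case (Suc L)
    have "rank_sum a A (i + L * Suc k) + \<epsilon> \<le> rank_sum a A (i + L * Suc k + Suc k)"
      using that by (intro step) simp
    then show ?case
      using Suc by (simp add: algebra_simps)
  qed simp
  obtain L where L: "C < real L * \<epsilon>"
    using reals_Archimedean3[OF \<open>0 < \<epsilon>\<close>] by blast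
  \<comment> \<open>\<open>i0 + 1\<close> skips the blocks without guarantee; the following
    \<open>L\<close> groups of \<open>k + 1\<close> blocks add more than \<open>C\<close>.\<close>
  have "block_rank A x \<le> block_rank A z + (i0 + 1 + L * Suc k)"
    if le: "side_sum a A x \<le> side_sum a A z + C" for x z
  proof (rule ccontr)
    assume "\<not> ?thesis"
    then have "rank_sum a A (block_rank A z + i0 + 1 + L * Suc k) \<le> rank_sum a A (block_rank A x)"
      by (intro rank_sum_mono) simp
    moreover have "rank_sum a A (Suc (block_rank A z)) \<le> rank_sum a A (block_rank A z + i0 + 1)"
      by (intro rank_sum_mono) simp
    ultimately show False
      using steps[of "block_rank A z + i0 + 1" L] L le
        rank_sum_le_side_sum[of x] side_sum_le_rank_sum[of z] by simp
  qed
  then show thesis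
    by (rule that)
qed

text \<open>Compared with position 0, where the sum is 0, a bound on the sums would bound the ranks,
  which take every positive value.\<close>

lemma side_sum_unbounded:
  assumes "substantial a A"
  shows "\<exists>x\<in>A. C < side_sum a A x"
proof -
  obtain K where K: "\<And>x z. side_sum a A x \<le> side_sum a A z + C \<Longrightarrow> block_rank A x \<le> block_rank A z + K"
    by (rule rank_gap[OF assms]) blast
  obtain x where x: "x \<in> A" "block_rank A x = Suc (block_rank A 0 + K)"
    using block_rank_surj[OF inf] by blast
  then have "\<not> side_sum a A x \<le> side_sum a A 0 + C"
    using K[of x 0] by auto
  then show ?thesis
    using x(1) by (intro bexI[of _ x]) (auto simp: side_sum_def)
qed

text \<open>The partial sums of the convergent rearrangement are bounded, so \<open>- A\<close> has
  to balance the growing contribution of \<open>A\<close>. Here the cut is taken just before an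
  element of \<open>A\<close>.\<close>

lemma side_sum_Compl_unbounded:
  assumes "substantial a A" "tame_perm A \<sigma>" "summable (\<lambda>n. a (\<sigma> n))"
  shows "\<exists>y. side_sum a (- A) y < C"
proof -
  obtain D where D: "\<And>n. \<bar>\<Sum>i<n. a (\<sigma> i)\<bar> \<le> D"
    by (rule partial_sums_bounded[OF assms(3)]) blast
  obtain x where x: "x \<in> A" "D - C < side_sum a A x"
    using side_sum_unbounded[OF assms(1)] by blast
  have \<sigma>: "bij \<sigma>" "keeps_order (- A) \<sigma>" "inj \<sigma>"
    using assms(2) by (auto simp: tame_perm_def keeps_order_Compl bij_is_inj)
  obtain n where n: "\<sigma> n = x"
    using \<sigma>(1) by (metis bij_pointE)
  obtain y where "\<sigma> ` {..<n} = sign_cut (- A) y x"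
    using initial_part_sign_cut_at[OF \<sigma>(1,2) inf(2), of n] n x(1) by auto
  then have "(\<Sum>i<n. a (\<sigma> i)) = side_sum a (- A) y + side_sum a A x"
    using partial_sum_sign_cut[OF \<sigma>(3), of n "- A" y x a] by simp
  then have "side_sum a (- A) y < C"
    using D[of n] x(2) by linarith
  then show ?thesis ..
qed

text \<open>
  The greedy rearrangement towards \<open>r\<close>, compared with a given tame rearrangement just before the
  same element of \<open>- A\<close>: the partial sums differ by a bounded amount, hence so do the contributions
  of \<open>A\<close>, and by substantiality so do the numbers of blocks of \<open>A\<close> that are used up.
\<close>

lemma sums_arbitrary_if_substantial:
  assumes "substantial a A" "tame_perm A \<sigma>" "summable (\<lambda>n. a (\<sigma> n))"
  shows "\<exists>\<tau>. tame_perm A \<tau> \<and> (\<lambda>n. a (\<tau> n)) sums r"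
proof -
  define pick where "pick F = (if sum a F \<le> r then Inf (A - F) else Inf (- A - F))" for F
  obtain \<tau> :: "nat \<Rightarrow> nat" where "\<forall>n. \<tau> n = pick (\<tau> ` {..<n})"
    using history_recursion[of pick] by blast
  note \<tau> = this[rule_format]
  have ne: "A - F \<noteq> {}" "- A - F \<noteq> {}" if "finite F" for F
    by (rule infinite_imp_nonempty[OF Diff_infinite_finite[OF that inf(1)]],
        rule infinite_imp_nonempty[OF Diff_infinite_finite[OF that inf(2)]])
  have pick: "pick F \<notin> F" "pick F \<in> A \<longleftrightarrow> sum a F \<le> r" if "finite F" for F
    using Inf_nat_def1[OF ne(1)[OF that]] Inf_nat_def1[OF ne(2)[OF that]]
    by (auto simp: pick_def)
  have pick_le: "pick F \<le> m" if "finite F" "m \<notin> F" "m \<in> A \<longleftrightarrow> pick F \<in> A" for F m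
    using pick(2)[OF that(1)] that by (auto simp: pick_def intro!: cInf_lower)
  have "\<tau> i \<noteq> \<tau> j" if "i < j" for i j
    using pick(1)[of "\<tau> ` {..<j}"] that \<tau>[of j] by force
  then have inj: "inj \<tau>"
    by (rule linorder_injI)
  define S where "S n = (\<Sum>i<n. a (\<tau> i))" for n
  have S_eq: "sum a (\<tau> ` {..<n}) = S n" for n
    unfolding S_def using sum.reindex[of \<tau> "{..<n}" a] inj_on_subset[OF inj] by simp
  have side: "\<tau> n \<in> A \<longleftrightarrow> S n \<le> r" for n
    using pick(2)[of "\<tau> ` {..<n}"] \<tau>[of n] S_eq by simp
  have least: "\<tau> j \<le> m" if "m \<in> A \<longleftrightarrow> \<tau> j \<in> A" "m \<notin> \<tau> ` {..<j}" for j m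
    using pick_le[of "\<tau> ` {..<j}" m] that \<tau>[of j] by simp
  \<comment> \<open>Otherwise almost all picks come from \<open>- A\<close> and drive the sums below
    \<open>r\<close> for good.\<close>
  have inf_le: "infinite {n. S n \<le> r}"
  proof
    assume fin: "finite {n. S n \<le> r}"
    have "\<exists>n0. \<forall>n\<ge>n0. (\<Sum>i<n. a (\<tau> i)) < r"
    proof (rule picks_least_diverges[OF inj, where B = "- A"])
      show "finite {j. \<tau> j \<notin> - A}"
        using fin side by simp
    qed (use least nonpos side_sum_Compl_unbounded[OF assms] in auto)
    then obtain n0 where "\<And>n. n0 \<le> n \<Longrightarrow> S n < r"
      unfolding S_def by blast
    then have "{n0..} \<subseteq> {n. S n \<le> r}"
      by (auto intro: less_imp_le)
    then show False
      using fin infinite_Ici finite_subset by blast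
  qed
  \<comment> \<open>Mirror case with \<open>\<lambda>n. - a n\<close>: almost all picks would come
    from \<open>A\<close>, whose sums exceed every bound.\<close>
  have inf_gt: "infinite {n. r < S n}"
  proof
    assume fin: "finite {n. r < S n}"
    have "\<exists>n0. \<forall>n\<ge>n0. (\<Sum>i<n. - a (\<tau> i)) < - r"
    proof (rule picks_least_diverges[OF inj, where B = A and a = "\<lambda>n. - a n"])
      show "finite {j. \<tau> j \<notin> A}"
        using fin side by (simp add: not_le)
      show "\<exists>y. side_sum (\<lambda>n. - a n) A y < C" for C
        using side_sum_unbounded[OF assms(1), of "- C"]
        by (auto simp: side_sum_def sum_negf minus_less_iff)
    qed (use least nonneg in auto)
    then obtain n0 where "\<And>n. n0 \<le> n \<Longrightarrow> r < S n"
      unfolding S_def sum_negf by auto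
    then have "{n0..} \<subseteq> {n. r < S n}"
      by auto
    then show False
      using fin infinite_Ici finite_subset by blast
  qed
  have "A \<subseteq> range \<tau>"
    by (rule picks_least_covers[OF inj]) (use least side inf_le in auto)
  moreover have "- A \<subseteq> range \<tau>"
    by (rule picks_least_covers[OF inj]) (use least side inf_gt in \<open>auto simp: not_le\<close>)
  ultimately have "surj \<tau>"
    by blast
  with inj have bij: "bij \<tau>"
    by (simp add: bij_def)
  have order: "keeps_order A \<tau>"
    unfolding keeps_order_def
  proof (intro allI impI)
    fix i j assume ij: "\<tau> i < \<tau> j \<and> (\<tau> i \<in> A \<longleftrightarrow> \<tau> j \<in> A)"
    show "i < j"
    proof (rule ccontr)
      assume "\<not> i < j"
      then have "\<tau> i \<notin> \<tau> ` {..<j}"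
        using inj by (auto dest: injD)
      then show False
        using least[of "\<tau> i" j] ij by auto
    qed
  qed
  have \<sigma>: "bij \<sigma>" "keeps_order A \<sigma>" "inj \<sigma>" "surj \<sigma>"
    using assms(2) by (auto simp: tame_perm_def bij_is_inj bij_is_surj)
  have "S \<longlonglongrightarrow> r"
  proof (rule steered_walk_converges)
    show "(\<lambda>n. S (Suc n) - S n) \<longlonglongrightarrow> 0"
      using tendsto_0_rearrange[OF summable_LIMSEQ_zero[OF assms(3)] \<sigma>(4) inj] by (simp add: S_def)
    show "S n \<le> S (Suc n)" if "S n \<le> r" for n
      using nonneg[of "\<tau> n"] side[of n] that by (simp add: S_def)
    show "S (Suc n) \<le> S n" if "r < S n" for n
      using nonpos[of "\<tau> n"] side[of n] that by (simp add: S_def)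
  qed (use inf_le inf_gt in auto)
  then have sums: "(\<lambda>n. a (\<tau> n)) sums r"
    by (simp add: sums_def S_def[abs_def])
  obtain C1 where C1: "\<And>n. \<bar>\<Sum>i<n. a (\<sigma> i)\<bar> \<le> C1"
    by (rule partial_sums_bounded[OF assms(3)]) blast
  obtain C2 where C2: "\<And>n. \<bar>\<Sum>i<n. a (\<tau> i)\<bar> \<le> C2"
    by (rule partial_sums_bounded[OF sums_summable[OF sums]]) blast
  obtain M where M: "\<And>y. y \<notin> A \<Longrightarrow> \<exists>n x. \<sigma> n = y \<and> x \<in> A \<and> ranks_within A M x y \<and>
      (\<Sum>i<n. a (\<sigma> i)) = side_sum a A x + side_sum a (- A) y"
    by (rule tame_perm_cut_at[OF assms(2)]) blast
  obtain K where K: "\<And>x z. side_sum a A x \<le> side_sum a A z + (C1 + C2) \<Longrightarrow>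
      block_rank A x \<le> block_rank A z + K"
    by (rule rank_gap[OF assms(1)]) blast
  have "ranks_within A (M + K) x y"
    if xy: "x \<in> A" "y \<notin> A" "\<tau> ` {..<n} = sign_cut A x y" for n x y
  proof -
    obtain m z where mz: "ranks_within A M z y"
      "(\<Sum>i<m. a (\<sigma> i)) = side_sum a A z + side_sum a (- A) y"
      using M[OF xy(2)] by blast
    have "side_sum a A x \<le> side_sum a A z + (C1 + C2)" "side_sum a A z \<le> side_sum a A x + (C1 + C2)"
      using mz(2) partial_sum_sign_cut[OF inj xy(3), of a] C1[of m] C2[of n] by linarith+
    then have "block_rank A x \<le> block_rank A z + K" "block_rank A z \<le> block_rank A x + K"
      using K by blast+
    then show ?thesis
      using mz(1) by (auto simp: ranks_within_def)
  qed
  then have "bounded_block_number \<tau>"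
    using bounded_block_number_iff[OF bij order inf] by blast
  then show ?thesis
    using bij order sums by (auto simp: tame_perm_def)
qed

end

subsection \<open>Type R rearrangements of conditionally divergent series\<close>

text \<open>Subtracting \<open>a\<close> from its positive part \<open>b\<close>, which has finite
  support, leaves a nonnegative series, and the convergence of such a series does not depend on the
  order.\<close>

lemma summable_if_finite_positive:
  fixes a :: "nat \<Rightarrow> real"
  assumes "bij \<sigma>" "summable (\<lambda>n. a (\<sigma> n))" "finite {n. 0 < a n}"
  shows "summable a"
proof -
  define b where "b n = (if 0 < a n then a n else 0)" for n
  have "finite (\<sigma> -` {n. 0 < a n})"
    using assms(1,3) by (intro finite_vimageI) (auto simp: bij_is_inj)
  then have "summable (\<lambda>n. b (\<sigma> n))"
    by (rule summable_finite) (auto simp: b_def)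
  from summable_diff[OF this assms(2)] have "summable (\<lambda>n. b (\<sigma> n) - a (\<sigma> n))" .
  then have "summable ((\<lambda>n. b (\<sigma> n) - a (\<sigma> n)) \<circ> inv \<sigma>)"
    using assms(1) by (intro summable_reindex) (auto simp: b_def bij_imp_bij_inv bij_is_inj)
  then have "summable (\<lambda>n. b n - a n)"
    using assms(1) by (simp add: o_def bij_is_surj surj_f_inv_f)
  moreover have "summable b"
    by (rule summable_finite[OF assms(3)]) (auto simp: b_def)
  ultimately show ?thesis
    using summable_diff[of b "\<lambda>n. b n - a n"] by simp
qed

text \<open>If one side were finite, the convergence of the rearrangement would carry over to the
  series itself; for the nonpositive side the argument runs on
  \<open>\<lambda>n. - a n\<close>.\<close>

lemma conditionally_divergent_infinite:
  assumes "conditionally_divergent a"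
  shows "infinite (pos_indices a)" "infinite (- pos_indices a)"
proof -
  obtain \<sigma> where \<sigma>: "bij \<sigma>" "summable (\<lambda>n. a (\<sigma> n))" and nsum: "\<not> summable a"
    using assms unfolding conditionally_divergent_def by blast
  show "infinite (pos_indices a)"
    using summable_if_finite_positive[OF \<sigma>] nsum by (auto simp: pos_indices_def)
  show "infinite (- pos_indices a)"
  proof
    assume "finite (- pos_indices a)"
    then have "finite {n. 0 < - a n}"
      by (rule rev_finite_subset) (auto simp: pos_indices_def)
    then have "summable (\<lambda>n. - a n)"
      using summable_if_finite_positive[of \<sigma> "\<lambda>n. - a n"] \<sigma> by (simp add: summable_minus)
    then show False
      using nsum summable_minus_iff by blast
  qed
qed

section \<open>The notions of the theorem in terms of one side\<close>

lemma neg_indices_eq: "neg_indices a = - pos_indices a"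
  by (auto simp: neg_indices_def pos_indices_def)

lemma type_R_lambda_perm_iff:
  "type_R_lambda_perm a \<sigma> \<longleftrightarrow> tame_perm (pos_indices a) \<sigma> \<and> summable (\<lambda>n. a (\<sigma> n))"
  unfolding type_R_lambda_perm_def tame_perm_def type_R_def keeps_order_def neg_indices_eq
  by blast

lemma Z_R_eq: "Z_R a = {r. \<exists>\<sigma>. tame_perm (pos_indices a) \<sigma> \<and> (\<lambda>n. a (\<sigma> n)) sums r}"
  unfolding Z_R_def type_R_lambda_perm_iff using sums_summable by blast

lemma ST_P_iff: "ST_P a \<longleftrightarrow> substantial a (pos_indices a)"
  by (simp add: ST_P_def substantial_def)

lemma ST_N_iff: "ST_N a \<longleftrightarrow> substantial (\<lambda>n. - a n) (- pos_indices a)"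
  by (simp add: ST_N_def substantial_def neg_indices_eq block_sum_def sum_negf le_minus_iff)

theorem theorem3p1:
  fixes a :: "nat \<Rightarrow> real"
  assumes "conditionally_divergent a"
  shows "((\<nexists>\<sigma>. type_R_lambda_perm a \<sigma>) \<longrightarrow> Z_R a = {}) \<and>
         ((\<exists>\<sigma>. type_R_lambda_perm a \<sigma>) \<longrightarrow>
            Z_R a \<noteq> {} \<and>
            (ST_P a \<and> ST_N a \<longrightarrow> Z_R a = UNIV) \<and>
            (\<not> ST_P a \<or> \<not> ST_N a \<longrightarrow> is_singleton (Z_R a)))"
proof (intro conjI impI)
  assume "\<nexists>\<sigma>. type_R_lambda_perm a \<sigma>"
  then show "Z_R a = {}"
    by (simp add: Z_R_def)
next
  assume "\<exists>\<sigma>. type_R_lambda_perm a \<sigma>"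
  then obtain \<sigma> where \<sigma>: "tame_perm (pos_indices a) \<sigma>" "summable (\<lambda>n. a (\<sigma> n))"
    unfolding type_R_lambda_perm_iff by blast
  interpret signed_series a "pos_indices a"
    using conditionally_divergent_infinite[OF assms]
    by unfold_locales (auto simp: pos_indices_def)
  \<comment> \<open>The mirrored series turns a failure of \<open>ST_N\<close> into a failure of
    substantiality on its nonnegative side.\<close>
  interpret dual: signed_series "\<lambda>n. - a n" "- pos_indices a"
    using conditionally_divergent_infinite[OF assms]
    by unfold_locales (auto simp: pos_indices_def)
  have mem: "(\<Sum>n. a (\<sigma> n)) \<in> Z_R a"
    using \<sigma> summable_sums unfolding Z_R_eq by blast
  then show "Z_R a \<noteq> {}"
    by blast
  show "Z_R a = UNIV" if "ST_P a \<and> ST_N a"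
    using sums_arbitrary_if_substantial[OF _ \<sigma>] that unfolding ST_P_iff Z_R_eq by blast
  show "is_singleton (Z_R a)" if "\<not> ST_P a \<or> \<not> ST_N a"
  proof (rule is_singletonI')
    fix r s assume "r \<in> Z_R a" "s \<in> Z_R a"
    then obtain \<rho> \<tau> where p: "tame_perm (pos_indices a) \<rho>" "tame_perm (pos_indices a) \<tau>"
      and sums: "(\<lambda>n. a (\<rho> n)) sums r" "(\<lambda>n. a (\<tau> n)) sums s"
      unfolding Z_R_eq by blast
    from that show "r = s"
    proof
      assume "\<not> ST_P a"
      then show ?thesis
        using sums_unique_if_not_substantial p sums unfolding ST_P_iff by blast
    next
      assume "\<not> ST_N a"
      then have "- r = - s"
        using p sums unfolding ST_N_iff
        by (intro dual.sums_unique_if_not_substantial[of \<rho> \<tau>])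
          (auto simp: tame_perm_Compl intro: sums_minus)
      then show ?thesis by simp
    qed
  qed (use mem in blast)
qed

end
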